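(* Let $n\ge 2$ and let $V$ be a finite-dimensional real vector space with an $n$-Lie algebra structure $[\cdot,\dots,\cdot]:\Lambda^nV\to V$ which is metric with respect to a positive definite inner product $\langle\cdot,\cdot\rangle$ (a Euclidean $n$-Lie algebra). Let $T\in\Lambda^{n+1}V$ be defined by $T(X_1,\dots,X_{n+1})=\langle[X_1,\dots,X_n],X_{n+1}\rangle$, assume $T\neq 0$, and assume $T$ is irreducible. Then either $n=2$ (so $V$ is a Lie algebra), or $n=\dim_{\mathbb{R}}V-1$ and $T$ is proportional to a volume form of $V$.
   Context: An $n$-Lie algebra structure on $V$ is an alternating $n$-linear map $[\cdot,\dots,\cdot]:\Lambda^nV\to V$ satisfying $[X_1,\dots,X_{n-1},[Y_1,\dots,Y_n]]=\sum_{i=1}^n[Y_1,\dots,[X_1,\dots,X_{n-1},Y_i],\dots,Y_n]$ for all $X_k,Y_k\in V$. It is metric with respect to $\langle\cdot,\cdot\rangle$ if $\langle[X_1,\dots,X_n],X_{n+1}\rangle=-\langle[X_1,\dots,X_{n-1},X_{n+1}],X_n\rangle$ for all $X_i$. Identify $\Lambda^2V$ with $\mathfrak{so}(V)$ via the inner product. A form $T\in\Lambda^pV$ is called irreducible if the Lie subalgebra $\mathfrak{r}_T\subseteq\mathfrak{so}(V)$ generated by all $2$-forms $X_1\lrcorner\cdots\lrcorner X_{p-2}\lrcorner T$ ($X_i\in V$) acts irreducibly on $V$. *)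

theory Defs
  imports "HOL-Analysis.Analysis"
begin

definition multilinear :: "nat \<Rightarrow> ('a::real_vector list \<Rightarrow> 'b::real_vector) \<Rightarrow> bool" where
  "multilinear k f \<longleftrightarrow>
     (\<forall>xs i. length xs = k \<longrightarrow> i < k \<longrightarrow> linear (\<lambda>y. f (xs[i := y])))"

definition alternating :: "nat \<Rightarrow> ('a list \<Rightarrow> 'b::zero) \<Rightarrow> bool" where
  "alternating k f \<longleftrightarrow>
     (\<forall>xs. length xs = k \<longrightarrow> (\<exists>i j. i < j \<and> j < k \<and> xs ! i = xs ! j) \<longrightarrow> f xs = 0)"

definition n_Lie :: "nat \<Rightarrow> ('a::real_vector list \<Rightarrow> 'a) \<Rightarrow> bool" where
  "n_Lie n br \<longleftrightarrow> multilinear n br \<and> alternating n br \<and>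
     (\<forall>Xs Ys. length Xs = n - 1 \<longrightarrow> length Ys = n \<longrightarrow>
        br (Xs @ [br Ys]) = (\<Sum>i<n. br (Ys[i := br (Xs @ [Ys ! i])])))"

definition metric_bracket :: "nat \<Rightarrow> ('a::real_inner list \<Rightarrow> 'a) \<Rightarrow> bool" where
  "metric_bracket n br \<longleftrightarrow>
     (\<forall>Xs Y Z. length Xs = n - 1 \<longrightarrow> inner (br (Xs @ [Y])) Z = - inner (br (Xs @ [Z])) Y)"

definition bracket_form :: "nat \<Rightarrow> ('a::real_inner list \<Rightarrow> 'a) \<Rightarrow> 'a list \<Rightarrow> real" where
  "bracket_form n br = (\<lambda>xs. inner (br (take n xs)) (xs ! n))"

definition contract :: "'a \<Rightarrow> ('a list \<Rightarrow> real) \<Rightarrow> ('a list \<Rightarrow> real)" where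
  "contract X \<omega> = (\<lambda>xs. \<omega> (X # xs))"

definition contract_list :: "'a list \<Rightarrow> ('a list \<Rightarrow> real) \<Rightarrow> ('a list \<Rightarrow> real)" where
  "contract_list Xs \<omega> = foldr contract Xs \<omega>"

text \<open>Identification of a 2-form with a skew endomorphism via the inner product:
  <A Y, Z> = \<omega>(Y,Z).\<close>
definition form_to_endo :: "('a::euclidean_space list \<Rightarrow> real) \<Rightarrow> 'a \<Rightarrow> 'a" where
  "form_to_endo \<omega> = (\<lambda>Y. \<Sum>b\<in>Basis. \<omega> [Y, b] *\<^sub>R b)"

inductive_set lie_gen :: "('a::real_vector \<Rightarrow> 'a) set \<Rightarrow> ('a \<Rightarrow> 'a) set" for S where
  gen: "A \<in> S \<Longrightarrow> A \<in> lie_gen S"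
| zero: "(\<lambda>x. 0) \<in> lie_gen S"
| add: "A \<in> lie_gen S \<Longrightarrow> B \<in> lie_gen S \<Longrightarrow> (\<lambda>x. A x + B x) \<in> lie_gen S"
| scale: "A \<in> lie_gen S \<Longrightarrow> (\<lambda>x. c *\<^sub>R A x) \<in> lie_gen S"
| bracket: "A \<in> lie_gen S \<Longrightarrow> B \<in> lie_gen S \<Longrightarrow> (\<lambda>x. A (B x) - B (A x)) \<in> lie_gen S"

definition acts_irreducibly :: "('a::real_vector \<Rightarrow> 'a) set \<Rightarrow> bool" where
  "acts_irreducibly L \<longleftrightarrow>
     (\<forall>W. subspace W \<longrightarrow> (\<forall>A\<in>L. \<forall>w\<in>W. A w \<in> W) \<longrightarrow> W = {0} \<or> W = UNIV)"

definition irreducible_form :: "nat \<Rightarrow> ('a::euclidean_space list \<Rightarrow> real) \<Rightarrow> bool" where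
  "irreducible_form p T \<longleftrightarrow>
     acts_irreducibly (lie_gen {form_to_endo (contract_list Xs T) | Xs. length Xs = p - 2})"

definition volume_form :: "('a::euclidean_space list \<Rightarrow> real) \<Rightarrow> bool" where
  "volume_form \<omega> \<longleftrightarrow> multilinear DIM('a) \<omega> \<and> alternating DIM('a) \<omega> \<and>
     (\<exists>bs. length bs = DIM('a) \<and>
        (\<forall>i<DIM('a). \<forall>j<DIM('a). inner (bs ! i) (bs ! j) = (if i = j then 1 else 0)) \<and>
        \<omega> bs = 1)"

end

theory Submission
  imports Defs
begin

text \<open>
  The metric and the fundamental identity say that \<open>T\<close> is an alternating form annihilated by all the
  skew endomorphisms obtained by contracting it with \<open>p - 2\<close> vectors, where \<open>p = n + 1\<close>. Choose unit
  vectors \<open>e\<^sub>1, \<dots>, e\<^sub>p\<close> at which \<open>T\<close> attains its maximum \<open>l > 0\<close>; the first variation shows that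
  they are orthonormal and that \<open>T\<close> vanishes when exactly one of them is replaced by a vector
  orthogonal to their span \<open>W\<close>. Contracting \<open>T\<close> with all but two of the \<open>e\<^sub>k\<close> yields endomorphisms
  \<open>M\<^sub>i\<^sub>j\<close> that satisfy the relations of \<open>so(p)\<close>, act on \<open>W\<close> by the standard representation, and
  preserve its orthogonal complement. The second variation bounds from above, by \<open>l\<close>, the symmetric
  operator \<open>B\<close> with blocks \<open>M\<^sub>i\<^sub>j\<close> on \<open>W\<^sup>\<bottom> \<otimes> \<real>\<^sup>p\<close>. The commutation relations give
  \<open>tr B = 0\<close> and \<open>tr B\<^sup>3 = (p - 2) / 2 \<cdot> l \<cdot> tr B\<^sup>2\<close>, so for \<open>p \<ge> 4\<close> the inequality
  \<open>tr ((l - B) (B + t)\<^sup>2) \<ge> 0\<close> with small \<open>t > 0\<close> forces \<open>B = 0\<close>. Hence the \<open>M\<^sub>i\<^sub>j\<close> act trivially on the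
  complement of \<open>W\<close>, and invariance of \<open>T\<close> shows that \<open>W\<close> is an ideal; by irreducibility it is the
  whole space.
\<close>

section \<open>Alternating multilinear maps\<close>

text \<open>Arguments are packed into a function on \<open>nat\<close> instead of a list, so that
  changing several slots is a chain of \<open>fun_upd\<close> without length conditions. Only the
  slots below \<open>k\<close> are constrained.\<close>

definition alt_multilinear :: "nat \<Rightarrow> ((nat \<Rightarrow> 'a::real_vector) \<Rightarrow> 'b::real_vector) \<Rightarrow> bool" where
  "alt_multilinear k G \<longleftrightarrow>
     (\<forall>x i. i < k \<longrightarrow> linear (\<lambda>y. G (x(i := y)))) \<and>
     (\<forall>x i j. i < k \<longrightarrow> j < k \<longrightarrow> i \<noteq> j \<longrightarrow> x i = x j \<longrightarrow> G x = 0)"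

lemma alt_multilinear_linear:
  "alt_multilinear k G \<Longrightarrow> i < k \<Longrightarrow> linear (\<lambda>y. G (x(i := y)))"
  by (simp add: alt_multilinear_def)

lemma alt_multilinear_zero:
  "alt_multilinear k G \<Longrightarrow> i < k \<Longrightarrow> j < k \<Longrightarrow> i \<noteq> j \<Longrightarrow> x i = x j \<Longrightarrow> G x = 0"
  by (simp add: alt_multilinear_def)

text \<open>Polarisation: with \<open>y + z\<close> in both slots, only the two mixed terms of the
  expansion survive.\<close>

lemma alt_multilinear_swap:
  assumes G: "alt_multilinear k G" and "i < k" "j < k" "i \<noteq> j"
  shows "G (x(i := z, j := y)) = - G (x(i := y, j := z))"
proof -
  have zero: "G (x(i := w, j := w)) = 0" for w
    using assms by (intro alt_multilinear_zero[OF G, of i j]) auto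
  have li: "G (x(i := u + v, j := w)) = G (x(i := u, j := w)) + G (x(i := v, j := w))" for u v w
    using linear_add[OF alt_multilinear_linear[OF G \<open>i < k\<close>, of "x(j := w)"], of u v] assms
    by (simp add: fun_upd_twist)
  have lj: "G (x(i := w, j := u + v)) = G (x(i := w, j := u)) + G (x(i := w, j := v))" for u v w
    using linear_add[OF alt_multilinear_linear[OF G \<open>j < k\<close>, of "x(i := w)"], of u v] by simp
  have "0 = G (x(i := y + z, j := y + z))"
    by (simp add: zero)
  also have "\<dots> = G (x(i := z, j := y)) + G (x(i := y, j := z))"
    unfolding li lj by (simp add: zero)
  finally have "G (x(i := z, j := y)) + G (x(i := y, j := z)) = 0"
    by (rule sym)
  then show ?thesis
    by (simp add: eq_neg_iff_add_eq_0)
qed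

lemma map_upt_fun_upd: "i < k \<Longrightarrow> map (x(i := y)) [0..<k] = (map x [0..<k])[i := y]"
  by (rule nth_equalityI) (auto simp: nth_list_update)

lemma alt_multilinear_of_lists:
  assumes "multilinear k f" "alternating k f"
  shows "alt_multilinear k (\<lambda>x. f (map x [0..<k]))"
proof -
  have "linear (\<lambda>y. f (map (x(i := y)) [0..<k]))" if "i < k" for x i
    using assms(1) that unfolding multilinear_def map_upt_fun_upd[OF that] by simp
  moreover have "f (map x [0..<k]) = 0" if "i < k" "j < k" "i \<noteq> j" "x i = x j" for x i j
  proof -
    have "\<exists>i j. i < j \<and> j < k \<and> map x [0..<k] ! i = map x [0..<k] ! j"
      using that by (intro exI[of _ "min i j"] exI[of _ "max i j"]) (auto simp: min_def max_def)
    then show ?thesis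
      using assms(2) by (simp add: alternating_def)
  qed
  ultimately show ?thesis
    by (simp add: alt_multilinear_def)
qed

text \<open>\<open>F\<close> contracted with all \<open>x k\<close> except at the two free slots
  \<open>i\<close> and \<open>j\<close>, read as an operator through the inner product. The entries
  \<open>x i\<close> and \<open>x j\<close> are overwritten.\<close>

definition contraction_endo ::
  "((nat \<Rightarrow> 'a::euclidean_space) \<Rightarrow> real) \<Rightarrow> nat \<Rightarrow> nat \<Rightarrow> (nat \<Rightarrow> 'a) \<Rightarrow> 'a \<Rightarrow> 'a" where
  "contraction_endo F i j x v = (\<Sum>b\<in>Basis. F (x(i := v, j := b)) *\<^sub>R b)"

lemma inner_sum_Basis_linear:
  fixes f :: "'a::euclidean_space \<Rightarrow> real"
  assumes "linear f"
  shows "inner (\<Sum>b\<in>Basis. f b *\<^sub>R b) w = f w"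
proof -
  have "f w = f (\<Sum>b\<in>Basis. inner w b *\<^sub>R b)"
    by (simp add: euclidean_representation)
  also have "\<dots> = (\<Sum>b\<in>Basis. inner w b * f b)"
    by (simp add: linear_sum[OF assms] linear_cmul[OF assms])
  also have "\<dots> = (\<Sum>b\<in>Basis. f b * inner b w)"
    by (simp add: inner_commute mult.commute)
  finally show ?thesis
    by (simp add: inner_sum_left)
qed

lemma inner_contraction_endo:
  assumes "alt_multilinear p F" "j < p"
  shows "inner (contraction_endo F i j x v) w = F (x(i := v, j := w))"
  unfolding contraction_endo_def
  by (rule inner_sum_Basis_linear) (rule alt_multilinear_linear[OF assms])

lemma multilinear_Cons:
  assumes "multilinear (Suc k) f"
  shows "multilinear k (\<lambda>xs. f (x # xs))"
  unfolding multilinear_def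
proof (intro allI impI)
  fix xs :: "'a list" and i assume "length xs = k" "i < k"
  then have "linear (\<lambda>y. f ((x # xs)[Suc i := y]))"
    using assms unfolding multilinear_def by (metis Suc_less_eq length_Cons)
  then show "linear (\<lambda>y. f (x # xs[i := y]))"
    by simp
qed

lemma multilinear_linear_hd:
  assumes "multilinear (Suc (length xs)) f"
  shows "linear (\<lambda>y. f (y # xs))"
proof -
  have "linear (\<lambda>y. f ((0 # xs)[0 := y]))"
    using assms unfolding multilinear_def by (metis length_Cons zero_less_Suc)
  then show ?thesis
    by simp
qed

section \<open>Homogeneity, continuity and the maximum of a multilinear form\<close>

lemma multilinear_scale:
  assumes "multilinear (length ks) f"
  shows "f (map (\<lambda>k. c k *\<^sub>R x k) ks) = (\<Prod>k\<leftarrow>ks. c k) *\<^sub>R f (map x ks)"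
  using assms
proof (induction ks arbitrary: f)
  case (Cons k ks)
  let ?ys = "map (\<lambda>k. c k *\<^sub>R x k) ks"
  have "f (map (\<lambda>k. c k *\<^sub>R x k) (k # ks)) = c k *\<^sub>R f (x k # ?ys)"
    using linear_cmul[OF multilinear_linear_hd[of ?ys f], of "c k" "x k"] Cons.prems by simp
  then show ?case
    using Cons.IH[of "\<lambda>ys. f (x k # ys)"] Cons.prems by (simp add: multilinear_Cons)
qed simp

text \<open>Expanding the first argument in \<open>Basis\<close> gives a finite sum of continuous
  coefficients times forms of lower degree, so induction on the list of argument functions
  applies.\<close>

lemma continuous_on_multilinear:
  fixes f :: "'a::euclidean_space list \<Rightarrow> real"
  assumes "multilinear (length cs) f" "\<And>c. c \<in> set cs \<Longrightarrow> continuous_on A c"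
  shows "continuous_on A (\<lambda>x. f (map (\<lambda>c. c x) cs))"
  using assms
proof (induction cs arbitrary: f)
  case (Cons c cs)
  have "f (map (\<lambda>c. c x) (c # cs)) = (\<Sum>b\<in>Basis. inner (c x) b * f (b # map (\<lambda>c. c x) cs))" for x
  proof -
    let ?ys = "map (\<lambda>c. c x) cs"
    have lin: "linear (\<lambda>y. f (y # ?ys))"
      using Cons.prems by (intro multilinear_linear_hd) simp
    have "f (c x # ?ys) = f ((\<Sum>b\<in>Basis. inner (c x) b *\<^sub>R b) # ?ys)"
      by (simp add: euclidean_representation)
    also have "\<dots> = (\<Sum>b\<in>Basis. inner (c x) b * f (b # ?ys))"
      by (simp add: linear_sum[OF lin] linear_cmul[OF lin])
    finally show ?thesis by simp
  qed
  moreover have "continuous_on A (\<lambda>x. \<Sum>b\<in>Basis. inner (c x) b * f (b # map (\<lambda>c. c x) cs))"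
    using Cons.prems
    by (intro continuous_intros Cons.IH[of "\<lambda>ys. f (_ # ys)"]) (auto intro: multilinear_Cons)
  ultimately show ?case
    by simp
qed simp

lemma multilinear_attains_max:
  fixes f :: "'a::euclidean_space list \<Rightarrow> real"
  assumes f: "multilinear k f"
  obtains e :: "nat \<Rightarrow> 'a" where "\<And>i. norm (e i) = 1"
    "\<And>x. f (map x [0..<k]) \<le> f (map e [0..<k]) * (\<Prod>i<k. norm (x i))"
proof -
  \<comment> \<open>The product of spheres runs over all of \<open>nat\<close>, so its compactness
    is Tychonoff's theorem and every \<open>e i\<close> is a unit vector, even for \<open>i\<close>
    beyond \<open>k\<close>.\<close>
  let ?S = "UNIV \<rightarrow>\<^sub>E sphere 0 1 :: (nat \<Rightarrow> 'a) set" and ?f = "\<lambda>x. f (map x [0..<k])"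
  have "compactin (product_topology (\<lambda>i::nat. euclidean :: 'a topology) UNIV) ?S"
    by (simp add: compactin_PiE)
  then have "compact ?S"
    by (simp add: euclidean_product_topology)
  moreover obtain u :: 'a where u: "norm u = 1"
    using vector_choose_size[of 1] by auto
  then have "(\<lambda>_. u) \<in> ?S"
    by (auto simp: PiE_def)
  then have "?S \<noteq> {}"
    by blast
  moreover have "continuous_on ?S ?f"
    using f continuous_on_multilinear[of "map (\<lambda>i x. x i) [0..<k]" f ?S]
    by (auto simp: o_def intro: continuous_on_subset[OF continuous_on_product_coordinates])
  ultimately obtain e where e: "e \<in> ?S" and max: "\<And>x. x \<in> ?S \<Longrightarrow> ?f x \<le> ?f e"
    using continuous_attains_sup by metis
  show thesis
  proof (rule that[of e])
    show "norm (e i) = 1" for i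
      using e by (auto simp: PiE_def Pi_def)
    show "f (map x [0..<k]) \<le> f (map e [0..<k]) * (\<Prod>i<k. norm (x i))" for x
    proof -
      \<comment> \<open>Since \<open>sgn 0\<close> is not a unit vector, zero entries are replaced
        by \<open>u\<close>; the factor \<open>norm (x i) = 0\<close> makes this choice
        harmless.\<close>
      define y where "y i = (if x i = 0 then u else sgn (x i))" for i
      have y: "y \<in> ?S"
        by (auto simp: y_def u norm_sgn)
      have x: "x i = norm (x i) *\<^sub>R y i" for i
        by (simp add: y_def sgn_div_norm)
      have "f (map x [0..<k]) = f (map (\<lambda>i. norm (x i) *\<^sub>R y i) [0..<k])"
        by (simp flip: x)
      also have "\<dots> = (\<Prod>i<k. norm (x i)) * ?f y"
        using multilinear_scale[of "[0..<k]" f "\<lambda>i. norm (x i)" y] f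
        by (simp add: interv_sum_list_conv_sum_set_nat prod.list_conv_set_nth atLeast0LessThan)
      also have "\<dots> \<le> (\<Prod>i<k. norm (x i)) * ?f e"
        using y by (intro mult_left_mono max prod_nonneg) auto
      finally show ?thesis
        by (simp add: mult.commute)
    qed
  qed
qed

lemma alt_multilinear_transpose:
  assumes G: "alt_multilinear k G" and "a < k" "b < k"
  shows "G (x \<circ> Transposition.transpose a b) = (if a = b then 1 else - 1) *\<^sub>R G x"
proof (cases "a = b")
  case False
  have "x \<circ> Transposition.transpose a b = x(a := x b, b := x a)"
    using False by (auto simp: fun_eq_iff Transposition.transpose_def)
  then show ?thesis
    using alt_multilinear_swap[OF G assms(2,3) False, of x "x b" "x a"] False by simp
qed simp

text \<open>A transposition moves the free slots; alternation turns this into a sign and a permuted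
  \<open>x\<close>, and \<open>base\<close> covers every \<open>x\<close>. Thus one pair of free
  slots yields all pairs.\<close>

lemma contraction_endo_derivation:
  assumes F: "alt_multilinear p F"
    and base: "\<And>x Y. (\<Sum>k<p. F (Y(k := contraction_endo F i0 j0 x (Y k)))) = 0"
    and ij0: "i0 < p" "j0 < p" "i0 \<noteq> j0"
    and ij: "i < p" "j < p" "i \<noteq> j"
  shows "(\<Sum>k<p. F (Y(k := contraction_endo F i j x (Y k)))) = 0"
proof -
  define D where "D i j \<longleftrightarrow> (\<forall>x Y. (\<Sum>k<p. F (Y(k := contraction_endo F i j x (Y k)))) = 0)" for i j
  have step: "D (Transposition.transpose a b i) (Transposition.transpose a b j)"
    if "D i j" "a < p" "b < p" for a b i j
    unfolding D_def
  proof (intro allI)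
    fix x Y
    let ?\<tau> = "Transposition.transpose a b"
    define s :: real where "s = (if a = b then 1 else - 1)"
    have "F (x(?\<tau> i := v, ?\<tau> j := w)) = s * F ((x \<circ> ?\<tau>)(i := v, j := w))" for v w
    proof -
      have "(x \<circ> ?\<tau>)(i := v, j := w) = x(?\<tau> i := v, ?\<tau> j := w) \<circ> ?\<tau>"
        by (auto simp: fun_eq_iff inj_eq[OF bij_is_inj[OF bij_transpose]])
      then show ?thesis
        using alt_multilinear_transpose[OF F that(2,3), of "x(?\<tau> i := v, ?\<tau> j := w)"]
        by (simp add: s_def)
    qed
    then have "contraction_endo F (?\<tau> i) (?\<tau> j) x v = s *\<^sub>R contraction_endo F i j (x \<circ> ?\<tau>) v" for v
      by (simp add: contraction_endo_def scaleR_sum_right)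
    then have "F (Y(k := contraction_endo F (?\<tau> i) (?\<tau> j) x (Y k))) =
        s * F (Y(k := contraction_endo F i j (x \<circ> ?\<tau>) (Y k)))" if "k < p" for k
      using linear_cmul[OF alt_multilinear_linear[OF F that, of Y]] by simp
    then show "(\<Sum>k<p. F (Y(k := contraction_endo F (?\<tau> i) (?\<tau> j) x (Y k)))) = 0"
      using \<open>D i j\<close> by (simp add: D_def flip: sum_distrib_left)
  qed
  \<comment> \<open>The position of \<open>j0\<close> after the exchange of \<open>i0\<close> and
    \<open>i\<close>. Exchanging \<open>m\<close> and \<open>j\<close> next leaves \<open>i\<close>
    fixed.\<close>
  define m where "m = Transposition.transpose i0 i j0"
  have m: "m < p" "m \<noteq> i"
    using ij0 ij by (auto simp: m_def Transposition.transpose_def)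
  have "D i0 j0"
    by (simp add: D_def base)
  then have "D i m"
    using step[of i0 j0 i0 i] ij0 ij by (simp add: m_def)
  then have "D i j"
    using step[of i m m j] m ij by simp
  then show ?thesis
    by (simp add: D_def)
qed

section \<open>Traces of endomorphisms\<close>

definition trace_endo :: "('a::euclidean_space \<Rightarrow> 'a) \<Rightarrow> real" where
  "trace_endo f = (\<Sum>u\<in>Basis. inner (f u) u)"

lemma trace_endo_comp_commute:
  fixes f g :: "'a::euclidean_space \<Rightarrow> 'a"
  assumes "linear f" "linear g"
  shows "trace_endo (\<lambda>u. f (g u)) = trace_endo (\<lambda>u. g (f u))"
proof -
  have expand: "trace_endo (\<lambda>u. f (g u)) = (\<Sum>u\<in>Basis. \<Sum>b\<in>Basis. inner (g u) b * inner (f b) u)"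
    if "linear f" for f g :: "'a \<Rightarrow> 'a"
    unfolding trace_endo_def
  proof (rule sum.cong[OF refl])
    fix u :: 'a
    have "f (g u) = f (\<Sum>b\<in>Basis. inner (g u) b *\<^sub>R b)"
      by (simp add: euclidean_representation)
    also have "\<dots> = (\<Sum>b\<in>Basis. inner (g u) b *\<^sub>R f b)"
      by (simp add: linear_sum[OF that] linear_cmul[OF that])
    finally show "inner (f (g u)) u = (\<Sum>b\<in>Basis. inner (g u) b * inner (f b) u)"
      by (simp add: inner_sum_left)
  qed
  show ?thesis
    unfolding expand[OF assms(1)] expand[OF assms(2)]
    by (subst sum.swap) (simp add: mult.commute)
qed

section \<open>Invariant forms and the second variation\<close>

text \<open>The fundamental identity together with the metric condition, expressed through the form
  alone: \<open>F\<close> is annihilated by the derivation extension of each of its own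
  contractions.\<close>

locale invariant_form =
  fixes p :: nat and F :: "(nat \<Rightarrow> 'a::euclidean_space) \<Rightarrow> real"
  assumes alt: "alt_multilinear p F"
    and invariant: "i < p \<Longrightarrow> j < p \<Longrightarrow> i \<noteq> j \<Longrightarrow>
      (\<Sum>k<p. F (Y(k := contraction_endo F i j x (Y k)))) = 0"
begin

lemmas form_linear = alt_multilinear_linear[OF alt]
lemmas form_zero = alt_multilinear_zero[OF alt]
lemmas form_swap = alt_multilinear_swap[OF alt]

lemma form_add: "i < p \<Longrightarrow> F (x(i := y + z)) = F (x(i := y)) + F (x(i := z))"
  using linear_add[OF form_linear] .

lemma form_scale: "i < p \<Longrightarrow> F (x(i := c *\<^sub>R y)) = c * F (x(i := y))"
  using linear_cmul[OF form_linear, of i x c y] by simp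

lemma form_0: "i < p \<Longrightarrow> F (x(i := 0)) = 0"
  using linear_0[OF form_linear] .

lemma form_minus: "i < p \<Longrightarrow> F (x(i := - y)) = - F (x(i := y))"
  using linear_neg[OF form_linear] .

lemma form_sum: "i < p \<Longrightarrow> F (x(i := (\<Sum>a\<in>A. g a))) = (\<Sum>a\<in>A. F (x(i := g a)))"
  using linear_sum[OF form_linear] .

text \<open>\<open>F\<close> is a polynomial in \<open>t\<close> along the perturbation. Adding a
  slot \<open>a\<close> to \<open>A\<close> adds \<open>t\<close> times the same expression with
  \<open>y a\<close> in slot \<open>a\<close>, so the induction hypothesis is used at both base
  points.\<close>

lemma form_taylor2:
  assumes "finite A" "A \<subseteq> {..<p}"
  shows "\<exists>R. continuous_on UNIV R \<and> (\<forall>t::real.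
     F (\<lambda>k. if k \<in> A then x k + t *\<^sub>R y k else x k) =
       F x + t * (\<Sum>i\<in>A. F (x(i := y i)))
       + t\<^sup>2 / 2 * (\<Sum>i\<in>A. \<Sum>j\<in>A. if i = j then 0 else F (x(i := y i, j := y j)))
       + t ^ 3 * R t)"
  using assms
proof (induction A arbitrary: x rule: finite_induct)
  case empty
  show ?case by (rule exI[of _ "\<lambda>_. 0"]) (auto intro: continuous_intros)
next
  case (insert a A)
  let ?x = "x(a := y a)"
  let ?Q = "\<lambda>x. \<Sum>i\<in>A. \<Sum>j\<in>A. if i = j then 0 else F (x(i := y i, j := y j))"
  let ?L = "\<lambda>x. \<Sum>i\<in>A. F (x(i := y i))"
  have a: "a < p" "A \<subseteq> {..<p}" using insert.prems by auto
  obtain R where R: "continuous_on UNIV R" and Req: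
    "\<And>t. F (\<lambda>k. if k \<in> A then x k + t *\<^sub>R y k else x k) = F x + t * ?L x + t\<^sup>2 / 2 * ?Q x + t ^ 3 * R t"
    using insert.IH[OF a(2), of x] by blast
  obtain R' where R': "continuous_on UNIV R'" and Req':
    "\<And>t. F (\<lambda>k. if k \<in> A then ?x k + t *\<^sub>R y k else ?x k) = F ?x + t * ?L ?x + t\<^sup>2 / 2 * ?Q ?x + t ^ 3 * R' t"
    using insert.IH[OF a(2), of ?x] by blast
  \<comment> \<open>Each pair consisting of \<open>a\<close> and an element of \<open>A\<close> is
    counted in both orders, which the factor 1/2 of \<open>t\<^sup>2 / 2\<close>
    compensates.\<close>
  have Q: "(\<Sum>i\<in>insert a A. \<Sum>j\<in>insert a A. if i = j then 0 else F (x(i := y i, j := y j)))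
       = ?Q x + 2 * ?L ?x"
  proof -
    have 1: "(\<Sum>j\<in>A. if a = j then 0 else F (x(a := y a, j := y j))) = ?L ?x"
      using insert.hyps by (intro sum.cong) auto
    have 2: "(\<Sum>i\<in>A. if i = a then 0 else F (x(i := y i, a := y a))) = ?L ?x"
      using insert.hyps by (intro sum.cong) (auto simp: fun_upd_twist)
    show ?thesis
      using insert.hyps by (simp add: sum.distrib 1 2)
  qed
  have split: "F (\<lambda>k. if k \<in> insert a A then x k + t *\<^sub>R y k else x k) =
     F (\<lambda>k. if k \<in> A then x k + t *\<^sub>R y k else x k)
     + t * F (\<lambda>k. if k \<in> A then ?x k + t *\<^sub>R y k else ?x k)" for t
  proof -
    let ?z = "\<lambda>k. if k \<in> A then x k + t *\<^sub>R y k else x k"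
    have "(\<lambda>k. if k \<in> insert a A then x k + t *\<^sub>R y k else x k) = ?z(a := x a + t *\<^sub>R y a)"
      using insert.hyps by auto
    moreover have "?z(a := x a) = ?z"
      using insert.hyps by auto
    moreover have "(\<lambda>k. if k \<in> A then ?x k + t *\<^sub>R y k else ?x k) = ?z(a := y a)"
      using insert.hyps by auto
    ultimately show ?thesis
      using form_add[OF a(1), of ?z "x a" "t *\<^sub>R y a"] form_scale[OF a(1), of ?z t "y a"] by simp
  qed
  show ?case
  proof (intro exI conjI allI)
    show "continuous_on UNIV (\<lambda>t. R t + ?Q ?x / 2 + t * R' t)"
      using R R' by (intro continuous_intros)
    fix t :: real
    have 1: "(\<Sum>i\<in>insert a A. F (x(i := y i))) = ?L x + F ?x"
      using insert.hyps by simp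
    show "F (\<lambda>k. if k \<in> insert a A then x k + t *\<^sub>R y k else x k) =
       F x + t * (\<Sum>i\<in>insert a A. F (x(i := y i)))
       + t\<^sup>2 / 2 * (\<Sum>i\<in>insert a A. \<Sum>j\<in>insert a A. if i = j then 0 else F (x(i := y i, j := y j)))
       + t ^ 3 * (R t + ?Q ?x / 2 + t * R' t)"
      unfolding split Req Req' Q 1
      by (simp add: algebra_simps power2_eq_square power3_eq_cube)
  qed
qed

end

section \<open>The orthonormal frame at a maximum and its contraction operators\<close>

locale maximal_invariant_form = invariant_form p F
  for p :: nat and F :: "(nat \<Rightarrow> 'a::euclidean_space) \<Rightarrow> real" +
  fixes e :: "nat \<Rightarrow> 'a" and l :: real
  assumes norm_e: "k < p \<Longrightarrow> norm (e k) = 1"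
    and l_pos: "l > 0"
    and F_e: "F e = l"
    and F_le: "F x \<le> l * (\<Prod>k<p. norm (x k))"
begin

text \<open>First variation: the vector \<open>z\<close> representing the functional has norm at
  most \<open>l\<close>, yet its inner product with the unit vector \<open>e i\<close> is
  \<open>l\<close>. Equality in Cauchy-Schwarz forces \<open>z = l *\<^sub>R e i\<close>.\<close>

lemma F_e_upd:
  assumes "i < p"
  shows "F (e(i := y)) = l * inner (e i) y"
proof -
  define z where "z = (\<Sum>b\<in>Basis. F (e(i := b)) *\<^sub>R b)"
  have z: "inner z w = F (e(i := w))" for w
    unfolding z_def by (rule inner_sum_Basis_linear) (rule form_linear[OF assms])
  have bound: "F (e(i := w)) \<le> l * norm w" for w
  proof -
    have "(\<Prod>k<p. norm ((e(i := w)) k)) = norm w * (\<Prod>k\<in>{..<p}-{i}. norm ((e(i := w)) k))"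
      using assms by (subst prod.remove[of _ i]) auto
    also have "(\<Prod>k\<in>{..<p}-{i}. norm ((e(i := w)) k)) = 1"
      by (rule prod.neutral) (auto simp: norm_e)
    finally show ?thesis
      using F_le[of "e(i := w)"] by simp
  qed
  have "norm z ^ 2 \<le> l * norm z"
    using bound[of z] z[of z] by (simp add: power2_norm_eq_inner)
  then have "norm z \<le> l"
    using l_pos by (cases "norm z = 0") (auto simp: power2_eq_square)
  then have nz: "inner z z \<le> l\<^sup>2"
    by (metis norm_ge_zero power2_norm_eq_inner power_mono)
  have ze: "inner z (e i) = l"
    by (simp add: z F_e)
  have ee: "inner (e i) (e i) = 1"
    using norm_e[OF assms] by (simp add: dot_square_norm)
  have "inner (z - l *\<^sub>R e i) (z - l *\<^sub>R e i) = inner z z - l\<^sup>2"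
    by (simp add: inner_diff_left inner_diff_right ze ee inner_commute[of "e i" z] power2_eq_square)
  then have "inner (z - l *\<^sub>R e i) (z - l *\<^sub>R e i) \<le> 0"
    using nz by simp
  then have "z = l *\<^sub>R e i"
    by (metis eq_iff_diff_eq_0 inner_ge_zero inner_eq_zero_iff order_antisym)
  then show ?thesis
    using z[of y] by simp
qed

text \<open>For distinct indices \<open>F (e(i := e j))\<close> is zero by alternation and
  \<open>l * inner (e i) (e j)\<close> by the first variation.\<close>

lemma inner_e:
  assumes "i < p" "j < p"
  shows "inner (e i) (e j) = (if i = j then 1 else 0)"
proof (cases "i = j")
  case True
  then show ?thesis
    using norm_e[OF assms(1)] by (simp add: dot_square_norm)
next
  case False
  have "l * inner (e i) (e j) = F (e(i := e j))"
    by (simp add: F_e_upd[OF assms(1)])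
  also have "\<dots> = 0"
    using assms False by (intro form_zero[of i j]) auto
  finally show ?thesis
    using l_pos False by simp
qed

lemma inj_on_e: "inj_on e {..<p}"
  by (rule inj_onI) (metis inner_e lessThan_iff zero_neq_one)

definition P :: "'a \<Rightarrow> 'a" where
  "P v = v - (\<Sum>k<p. inner (e k) v *\<^sub>R e k)"

text \<open>The value 0 on the diagonal lets double sums over \<open>i\<close> and \<open>j\<close>
  run without side conditions.\<close>

definition M :: "nat \<Rightarrow> nat \<Rightarrow> 'a \<Rightarrow> 'a" where
  "M i j v = (if i = j then 0 else contraction_endo F i j e v)"

lemma linear_P: "linear P"
  by (rule linearI)
    (simp_all add: P_def inner_add_right scaleR_add_left sum.distrib scaleR_diff_right scaleR_sum_right)

lemma inner_e_P: "i < p \<Longrightarrow> inner (e i) (P v) = 0"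
  by (simp add: P_def inner_diff_right inner_sum_right inner_e sum.If_cases if_distrib[of "\<lambda>x. _ * x"] cong: if_cong)

lemma P_eq_self: "(\<And>i. i < p \<Longrightarrow> inner (e i) v = 0) \<Longrightarrow> P v = v"
  by (simp add: P_def)

lemma P_P: "P (P v) = P v"
  by (simp add: P_eq_self inner_e_P)

lemma P_e: "i < p \<Longrightarrow> P (e i) = 0"
  by (simp add: P_def inner_e sum.If_cases if_distrib[of "\<lambda>x. x *\<^sub>R _"] cong: if_cong)

lemma inner_P: "inner (P v) w = inner v (P w)"
proof -
  have 1: "inner (P a) b = inner a b - (\<Sum>k<p. inner (e k) a * inner (e k) b)" for a b
    by (simp add: P_def inner_diff_left inner_sum_left)
  have "inner v (P w) = inner (P w) v"
    by (rule inner_commute)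
  also have "\<dots> = inner (P v) w"
    unfolding 1 by (simp add: inner_commute[of w v] mult.commute)
  finally show ?thesis by simp
qed

lemma inner_M:
  "i < p \<Longrightarrow> j < p \<Longrightarrow> inner (M i j v) w = (if i = j then 0 else F (e(i := v, j := w)))"
  by (simp add: M_def inner_contraction_endo[OF alt])

lemma linear_M: "i < p \<Longrightarrow> j < p \<Longrightarrow> linear (M i j)"
  by (cases "i = j"; rule linearI; rule vector_eq_rdot[THEN iffD1], rule allI)
    (simp_all add: inner_M inner_add_left form_add form_scale fun_upd_twist[of i j])

lemma M_self: "M i i v = 0"
  by (simp add: M_def)

lemma M_swap: "i < p \<Longrightarrow> j < p \<Longrightarrow> M j i v = - M i j v"
proof (rule vector_eq_rdot[THEN iffD1], rule allI)
  fix w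
  assume ij: "i < p" "j < p"
  show "inner (M j i v) w = inner (- M i j v) w"
  proof (cases "i = j")
    case False
    have "F (e(j := v, i := w)) = F (e(i := w, j := v))"
      using False by (simp add: fun_upd_twist)
    also have "\<dots> = - F (e(i := v, j := w))"
      using ij False by (rule form_swap)
    finally show ?thesis
      using False ij by (simp add: inner_M)
  qed (simp add: M_self)
qed

lemma M_skew: "i < p \<Longrightarrow> j < p \<Longrightarrow> inner (M i j v) w = - inner v (M i j w)"
  using form_swap[of i j e w v]
  by (simp add: inner_commute[of v] inner_M)

lemma M_e:
  assumes "i < p" "j < p" "i \<noteq> j" "k < p"
  shows "M i j (e k) = (if k = i then l *\<^sub>R e j else if k = j then - l *\<^sub>R e i else 0)"
proof (rule vector_eq_rdot[THEN iffD1], rule allI)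
  fix w
  consider "k = i" | "k = j" | "k \<noteq> i" "k \<noteq> j" by auto
  then show "inner (M i j (e k)) w =
      inner (if k = i then l *\<^sub>R e j else if k = j then - l *\<^sub>R e i else 0) w"
  proof cases
    case 1
    then show ?thesis
      using assms by (simp add: inner_M F_e_upd)
  next
    case 2
    have "F (e(i := e j, j := w)) = - F (e(i := w))"
      using form_swap[OF assms(1,2,3), of e "e j" w] assms(3) by (simp add: fun_upd_idem)
    then show ?thesis
      using assms 2 by (simp add: inner_M F_e_upd)
  next
    case 3
    have "F (e(i := e k, j := w)) = 0"
      using assms 3 by (intro form_zero[of i k]) auto
    then show ?thesis
      using assms 3 by (simp add: inner_M)
  qed
qed

lemma M_invariant:
  assumes "i < p" "j < p"
  shows "(\<Sum>k<p. F (Y(k := M i j (Y k)))) = 0"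
proof (cases "i = j")
  case True
  then show ?thesis
    by (simp add: M_self form_0)
next
  case False
  then show ?thesis
    using invariant[of i j Y e] assms by (simp add: M_def)
qed

text \<open>Skewness moves \<open>M i j\<close> onto \<open>e k\<close>, and \<open>M_e\<close>
  keeps the result in the span of the frame.\<close>

lemma inner_e_M:
  assumes "i < p" "j < p" "k < p" "\<And>i. i < p \<Longrightarrow> inner (e i) v = 0"
  shows "inner (e k) (M i j v) = 0"
proof (cases "i = j")
  case False
  have "inner (e k) (M i j v) = - inner v (M i j (e k))"
    using M_skew[of i j v "e k"] assms by (simp add: inner_commute)
  also have "\<dots> = 0"
    using False assms by (simp add: M_e inner_commute[of v])
  finally show ?thesis .
qed (simp add: M_self)

text \<open>Invariance under \<open>M a j\<close> at the arguments \<open>e(i := v, j := w)\<close>: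
  slots \<open>i\<close> and \<open>j\<close> give the two products, slot \<open>a\<close> gives the
  right-hand side after a swap, and all other frame vectors are killed.\<close>

lemma M_commutator:
  assumes "i < p" "j < p" "a < p" "i \<noteq> j" "j \<noteq> a" "i \<noteq> a"
  shows "M i j (M a j v) - M a j (M i j v) = l *\<^sub>R M i a v"
proof (rule vector_eq_rdot[THEN iffD1], rule allI)
  fix w
  let ?Y = "e(i := v, j := w)"
  have other: "F (?Y(k := M a j (?Y k))) = 0" if "k \<in> {..<p} - {a, i, j}" for k
    using that assms by (simp add: M_e form_0)
  have "(\<Sum>k<p. F (?Y(k := M a j (?Y k)))) =
      (\<Sum>k\<in>{a, i, j}. F (?Y(k := M a j (?Y k))))"
    using assms other by (intro sum.mono_neutral_right) auto
  then have "(\<Sum>k\<in>{a, i, j}. F (?Y(k := M a j (?Y k)))) = 0"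
    using M_invariant[of a j ?Y] assms by simp
  then have 1: "F (?Y(a := l *\<^sub>R e j)) + F (e(i := M a j v, j := w)) + F (e(i := v, j := M a j w)) = 0"
    using assms by (simp add: M_e fun_upd_twist[of i j])
  have "F (?Y(a := e j)) = - F ((e(i := v))(j := e j, a := w))"
    using assms by (intro form_swap) auto
  moreover have "(e(i := v))(j := e j, a := w) = e(i := v, a := w)"
    using assms by auto
  ultimately have 2: "F (?Y(a := l *\<^sub>R e j)) = - l * inner (M i a v) w"
    using assms by (simp add: inner_M form_scale)
  have 3: "F (e(i := M a j v, j := w)) = inner (M i j (M a j v)) w"
    using assms by (simp add: inner_M)
  have 4: "F (e(i := v, j := M a j w)) = - inner (M a j (M i j v)) w"
    using assms M_skew[of a j "M i j v" w] by (simp add: inner_M)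
  show "inner (M i j (M a j v) - M a j (M i j v)) w = inner (l *\<^sub>R M i a v) w"
    using 1 unfolding 2 3 4 by (simp add: inner_diff_left)
qed

text \<open>Compare the expansion of \<open>F\<close> at \<open>e k + t *\<^sub>R v k\<close> with
  \<open>F_le\<close>. Orthogonality removes the first-order term, so dividing by
  \<open>t\<^sup>2\<close> and letting \<open>t\<close> tend to 0 from the right compares the
  second-order terms.\<close>

lemma second_variation:
  assumes v: "\<And>i k. i < p \<Longrightarrow> k < p \<Longrightarrow> inner (e i) (v k) = 0"
  shows "(\<Sum>i<p. \<Sum>j<p. inner (M i j (v i)) (v j)) \<le> l * (\<Sum>k<p. (norm (v k))\<^sup>2)"
    (is "?Q \<le> l * ?s")
proof -
  obtain R where R: "continuous_on UNIV R" and Req: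
    "\<And>t. F (\<lambda>k. if k \<in> {..<p} then e k + t *\<^sub>R v k else e k) =
       F e + t * (\<Sum>i<p. F (e(i := v i)))
       + t\<^sup>2 / 2 * (\<Sum>i<p. \<Sum>j<p. if i = j then 0 else F (e(i := v i, j := v j)))
       + t ^ 3 * R t"
    using form_taylor2[of "{..<p}" e v] by blast
  have first: "(\<Sum>i<p. F (e(i := v i))) = 0"
    by (rule sum.neutral) (simp add: F_e_upd v)
  have second: "(\<Sum>i<p. \<Sum>j<p. if i = j then 0 else F (e(i := v i, j := v j))) = ?Q"
    by (intro sum.cong refl) (simp add: inner_M)
  have s0: "?s \<ge> 0"
    by (simp add: sum_nonneg)
  \<comment> \<open>The exponential bound turns the product of norms into a single exponential of a
    sum.\<close>
  have norm_le: "norm (e k + t *\<^sub>R v k) \<le> exp (t\<^sup>2 * (norm (v k))\<^sup>2 / 2)" if "k < p" for k t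
  proof (rule power2_le_imp_le)
    have "(norm (e k + t *\<^sub>R v k))\<^sup>2 = 1 + t\<^sup>2 * (norm (v k))\<^sup>2"
      unfolding power2_norm_eq_inner using v[OF that that] inner_e[OF that that]
      by (simp add: inner_add_left inner_add_right inner_commute[of "v k" "e k"] power2_eq_square)
    also have "\<dots> \<le> exp (t\<^sup>2 * (norm (v k))\<^sup>2)"
      by (rule exp_ge_add_one_self)
    also have "\<dots> = (exp (t\<^sup>2 * (norm (v k))\<^sup>2 / 2))\<^sup>2"
      by (simp add: exp_double[symmetric])
    finally show "(norm (e k + t *\<^sub>R v k))\<^sup>2 \<le> (exp (t\<^sup>2 * (norm (v k))\<^sup>2 / 2))\<^sup>2" .
  qed simp
  have main: "l + t\<^sup>2 / 2 * ?Q + t ^ 3 * R t \<le> l * exp (t\<^sup>2 * ?s / 2)" for t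
  proof -
    have "l + t\<^sup>2 / 2 * ?Q + t ^ 3 * R t \<le> l * (\<Prod>k<p. norm (e k + t *\<^sub>R v k))"
      using F_le[of "\<lambda>k. if k \<in> {..<p} then e k + t *\<^sub>R v k else e k"]
      unfolding Req first second by (simp add: F_e)
    also have "(\<Prod>k<p. norm (e k + t *\<^sub>R v k)) \<le> (\<Prod>k<p. exp (t\<^sup>2 * (norm (v k))\<^sup>2 / 2))"
      by (rule prod_mono) (auto intro: norm_le)
    also have "\<dots> = exp (t\<^sup>2 * ?s / 2)"
      by (simp add: exp_sum sum_distrib_left sum_divide_distrib)
    finally show ?thesis
      using l_pos by simp
  qed
  \<comment> \<open>The condition \<open>t\<^sup>2 * ?s \<le> 2\<close> keeps the exponent in the
    unit interval, as \<open>exp_bound\<close> requires.\<close>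
  have le: "?Q / 2 + t * R t \<le> l * ?s / 2 + l * (t\<^sup>2 * ?s\<^sup>2 / 4)" if "0 < t" "t\<^sup>2 * ?s \<le> 2" for t
  proof -
    have "exp (t\<^sup>2 * ?s / 2) \<le> 1 + t\<^sup>2 * ?s / 2 + (t\<^sup>2 * ?s / 2)\<^sup>2"
      using that s0 by (intro exp_bound) auto
    then have "l * exp (t\<^sup>2 * ?s / 2) \<le> l * (1 + t\<^sup>2 * ?s / 2 + (t\<^sup>2 * ?s / 2)\<^sup>2)"
      using l_pos by simp
    with main[of t] have "l + t\<^sup>2 / 2 * ?Q + t ^ 3 * R t \<le> l * (1 + t\<^sup>2 * ?s / 2 + (t\<^sup>2 * ?s / 2)\<^sup>2)"
      by (rule order_trans)
    then have "t\<^sup>2 * (?Q / 2 + t * R t) \<le> t\<^sup>2 * (l * ?s / 2 + l * (t\<^sup>2 * ?s\<^sup>2 / 4))"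
      by (simp add: algebra_simps power2_eq_square power3_eq_cube)
    then show ?thesis
      using \<open>0 < t\<close> by simp
  qed
  have lim: "((\<lambda>t. t\<^sup>2 * ?s) \<longlongrightarrow> 0\<^sup>2 * ?s) (at_right 0)"
    by (intro tendsto_intros)
  have "\<forall>\<^sub>F t in at_right 0. t\<^sup>2 * ?s < 2"
    using order_tendstoD(2)[OF lim, of 2] by simp
  then have ev: "\<forall>\<^sub>F t in at_right 0. 0 < t \<and> t\<^sup>2 * ?s \<le> 2"
    using eventually_at_right_less[of "0::real"] by eventually_elim simp
  have "isCont R 0"
    using R by (simp add: continuous_on_eq_continuous_at)
  then have "(R \<longlongrightarrow> R 0) (at_right 0)"
    by (simp add: isCont_def filterlim_at_split)
  then have 1: "((\<lambda>t. ?Q / 2 + t * R t) \<longlongrightarrow> ?Q / 2 + 0 * R 0) (at_right 0)"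
    by (intro tendsto_intros)
  have 2: "((\<lambda>t. l * ?s / 2 + l * (t\<^sup>2 * ?s\<^sup>2 / 4)) \<longlongrightarrow> l * ?s / 2 + l * (0\<^sup>2 * ?s\<^sup>2 / 4)) (at_right 0)"
    by (intro tendsto_intros) auto
  have "?Q / 2 + 0 * R 0 \<le> l * ?s / 2 + l * (0\<^sup>2 * ?s\<^sup>2 / 4)"
  proof (rule tendsto_le[OF _ 2 1])
    show "\<forall>\<^sub>F t in at_right 0. ?Q / 2 + t * R t \<le> l * ?s / 2 + l * (t\<^sup>2 * ?s\<^sup>2 / 4)"
      by (rule eventually_mono[OF ev]) (rule le, auto)
  qed simp
  then show ?thesis
    by simp
qed

section \<open>Operators on the complement of the frame and their trace identities\<close>

text \<open>\<open>M i j\<close> restricted to the complement of the frame and extended by 0 to its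
  span, so that traces can be taken over \<open>Basis\<close> of the whole space.\<close>

definition N :: "nat \<Rightarrow> nat \<Rightarrow> 'a \<Rightarrow> 'a" where
  "N i j v = M i j (P v)"

lemma P_M:
  assumes "i < p" "j < p"
  shows "P (M i j (P v)) = M i j (P v)"
  using assms by (intro P_eq_self inner_e_M inner_e_P)

lemma P_N: "i < p \<Longrightarrow> j < p \<Longrightarrow> P (N i j v) = N i j v"
  by (simp add: N_def P_M)

lemma inner_e_N: "i < p \<Longrightarrow> j < p \<Longrightarrow> k < p \<Longrightarrow> inner (e k) (N i j v) = 0"
  by (simp add: N_def inner_e_M inner_e_P)

lemma linear_N: "i < p \<Longrightarrow> j < p \<Longrightarrow> linear (N i j)"
  unfolding N_def using linear_compose[OF linear_P linear_M] by (simp add: o_def)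

lemma N_self: "N i i v = 0"
  by (simp add: N_def M_self)

lemma N_swap: "i < p \<Longrightarrow> j < p \<Longrightarrow> N j i v = - N i j v"
  unfolding N_def by (rule M_swap)

lemma N_minus: "i < p \<Longrightarrow> j < p \<Longrightarrow> N i j (- v) = - N i j v"
  by (rule linear_neg[OF linear_N])

lemma N_skew:
  assumes "i < p" "j < p"
  shows "inner (N i j v) w = - inner v (N i j w)"
proof -
  have "inner (N i j v) w = inner (N i j v) (P w)"
    using assms by (simp add: inner_P[symmetric] P_N)
  also have "\<dots> = - inner (P v) (M i j (P w))"
    unfolding N_def using assms by (rule M_skew)
  also have "\<dots> = - inner v (N i j w)"
    using assms by (simp add: inner_P N_def P_M)
  finally show ?thesis .
qed

lemma N_commutator:
  assumes "i < p" "j < p" "a < p" "i \<noteq> j" "j \<noteq> a" "i \<noteq> a"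
  shows "N i j (N a j v) - N a j (N i j v) = l *\<^sub>R N i a v"
  using M_commutator[OF assms, of "P v"] assms by (simp add: N_def P_M)

definition K :: real where
  "K = (\<Sum>a<p. \<Sum>j<p. \<Sum>u\<in>Basis. (norm (N a j u))\<^sup>2)"

lemma trace_N_square:
  assumes "i < p" "j < p"
  shows "trace_endo (\<lambda>u. N i j (N i j u)) = - (\<Sum>u\<in>Basis. (norm (N i j u))\<^sup>2)"
  using assms by (simp add: trace_endo_def N_skew[of i j "N i j _" _] power2_norm_eq_inner sum_negf)

text \<open>By cyclicity the two traces combine into that of \<open>N i j\<close> times the
  commutator of \<open>N a i\<close> and \<open>N a j\<close>, which is \<open>l\<close> times
  \<open>N i j\<close>. If two indices coincide, a factor in each product vanishes.\<close>

lemma trace_N_cube_antisym: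
  assumes "i < p" "j < p" "a < p"
  shows "trace_endo (\<lambda>u. N a j (N i j (N a i u))) + trace_endo (\<lambda>u. N a i (N j i (N a j u)))
    = (if i = j \<or> i = a \<or> j = a then 0 else l * trace_endo (\<lambda>u. N i j (N i j u)))"
proof -
  have zero: ?thesis if "i = j \<or> i = a \<or> j = a"
    using that linear_0[OF linear_N] assms by (auto simp: trace_endo_def N_self)
  have ?thesis if "i \<noteq> j" "i \<noteq> a" "j \<noteq> a"
  proof -
    have 1: "trace_endo (\<lambda>u. N a j (N i j (N a i u))) = trace_endo (\<lambda>u. N i j (N a i (N a j u)))"
      using assms
        trace_endo_comp_commute[OF linear_N[of a j] linear_compose[OF linear_N[of a i] linear_N[of i j]]]
      by (simp add: o_def)
    have "trace_endo (\<lambda>u. N a i (N j i (N a j u))) = trace_endo (\<lambda>u. N j i (N a j (N a i u)))"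
      using assms
        trace_endo_comp_commute[OF linear_N[of a i] linear_compose[OF linear_N[of a j] linear_N[of j i]]]
      by (simp add: o_def)
    also have "\<dots> = - trace_endo (\<lambda>u. N i j (N a j (N a i u)))"
      using assms by (simp add: trace_endo_def N_swap[of i j] sum_negf)
    finally have 2: "trace_endo (\<lambda>u. N a i (N j i (N a j u))) = - trace_endo (\<lambda>u. N i j (N a j (N a i u)))" .
    have c: "N i j (N a i (N a j u)) - N i j (N a j (N a i u)) = l *\<^sub>R N i j (N i j u)" for u
    proof -
      have "N a i (N a j u) - N a j (N a i u) = l *\<^sub>R N i j u"
        using N_commutator[of i a j u] assms that
        by (simp add: N_swap[of a i] N_swap[of a j] N_minus)
      then have "N i j (N a i (N a j u) - N a j (N a i u)) = N i j (l *\<^sub>R N i j u)"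
        by (rule arg_cong)
      then show ?thesis
        using assms by (simp add: linear_diff[OF linear_N[of i j]] linear_cmul[OF linear_N[of i j]])
    qed
    show ?thesis
      unfolding 1 2 using that
      by (simp add: trace_endo_def sum_subtractf[symmetric] inner_diff_left[symmetric] c sum_distrib_left)
  qed
  with zero show ?thesis
    by blast
qed

text \<open>
  In terms of the endomorphism \<open>B w = (\<Sum>i. N i j (w i))\<^sub>j\<close> of \<open>W\<^sup>\<bottom> \<otimes> \<real>\<^sup>p\<close> this is
  \<open>2 tr B\<^sup>3 = l (p - 2) tr B\<^sup>2\<close>, since \<open>K = tr B\<^sup>2\<close>.
\<close>

lemma sum_trace_N_cube:
  "2 * (\<Sum>a<p. \<Sum>i<p. \<Sum>j<p. trace_endo (\<lambda>u. N a j (N i j (N a i u)))) = - l * (real p - 2) * K"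
proof -
  let ?t = "\<lambda>a i j. trace_endo (\<lambda>u. N a j (N i j (N a i u)))"
  let ?k = "\<lambda>i j. \<Sum>u\<in>Basis. (norm (N i j u))\<^sup>2"
  \<comment> \<open>Each \<open>?t a i j\<close> is minus a term of the trace of the cube, because
    \<open>N j a = - N a j\<close>. Renaming \<open>i\<close> and \<open>j\<close> symmetrises the
    sum so that \<open>trace_N_cube_antisym\<close> applies termwise.\<close>
  have "(\<Sum>a<p. \<Sum>i<p. \<Sum>j<p. ?t a i j) = (\<Sum>a<p. \<Sum>i<p. \<Sum>j<p. ?t a j i)"
    by (rule sum.cong[OF refl]) (rule sum.swap)
  then have "2 * (\<Sum>a<p. \<Sum>i<p. \<Sum>j<p. ?t a i j) = (\<Sum>a<p. \<Sum>i<p. \<Sum>j<p. ?t a i j + ?t a j i)"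
    by (simp add: sum.distrib)
  also have "\<dots> = (\<Sum>a<p. \<Sum>i<p. \<Sum>j<p. if i = j \<or> i = a \<or> j = a then 0 else - l * ?k i j)"
    by (intro sum.cong refl) (auto simp: trace_N_cube_antisym trace_N_square)
  also have "\<dots> = (\<Sum>i<p. \<Sum>j<p. \<Sum>a<p. if i = j \<or> i = a \<or> j = a then 0 else - l * ?k i j)"
    by (subst sum.swap, rule sum.cong[OF refl], rule sum.swap)
  also have "\<dots> = (\<Sum>i<p. \<Sum>j<p. - l * (real p - 2) * ?k i j)"
  proof (intro sum.cong refl)
    fix i j assume ij: "i \<in> {..<p}" "j \<in> {..<p}"
    show "(\<Sum>a<p. if i = j \<or> i = a \<or> j = a then 0 else - l * ?k i j) = - l * (real p - 2) * ?k i j"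
    proof (cases "i = j")
      case True
      then show ?thesis by (simp add: N_self)
    next
      case False
      \<comment> \<open>The factor \<open>real p - 2\<close> counts the indices \<open>a\<close>
        different from \<open>i\<close> and \<open>j\<close>.\<close>
      have "(\<Sum>a<p. if i = j \<or> i = a \<or> j = a then 0 else - l * ?k i j) = (\<Sum>a\<in>{..<p} - {i, j}. - l * ?k i j)"
        using False by (intro sum.mono_neutral_cong_right) auto
      also have "\<dots> = real (card ({..<p} - {i, j})) * (- l * ?k i j)"
        by simp
      also have "real (card ({..<p} - {i, j})) = real p - 2"
        using ij False by (subst card_Diff_subset) (auto simp: of_nat_diff)
      finally show ?thesis by simp
    qed
  qed
  also have "\<dots> = - l * (real p - 2) * K"
    by (simp add: K_def sum_distrib_left)
  finally show ?thesis .
qed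

text \<open>In \<open>ineq\<close> the left side is the trace of \<open>B (B + t)\<^sup>2\<close>,
  whose part linear in \<open>B\<close> drops out because \<open>N a a = 0\<close>; the right side
  is \<open>l\<close> times the trace of \<open>(B + t)\<^sup>2\<close>.\<close>

lemma N_eq_0:
  assumes "p \<ge> 4" "i < p" "j < p"
  shows "N i j v = 0"
proof -
  let ?B = "Basis :: 'a set"
  \<comment> \<open>The trace of the projection \<open>P\<close>, hence the dimension of the
    complement; \<open>real p * d\<close> is the trace of the identity.\<close>
  define d where "d = (\<Sum>u\<in>?B. (norm (P u))\<^sup>2)"
  have ineq: "l * (real p - 2) / 2 * K + 2 * t * K \<le> l * (K + t\<^sup>2 * (real p * d))" for t
  proof -
    \<comment> \<open>The images of the basis vectors of \<open>W\<^sup>\<bottom> \<otimes> \<real>\<^sup>p\<close> under \<open>B + t\<close>, so that summing the second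
      variation inequality bounds the trace of \<open>B (B + t)\<^sup>2\<close> by that of \<open>l (B + t)\<^sup>2\<close>.\<close>
    define w where "w = (\<lambda>a u j. N a j u + (if j = a then t *\<^sub>R P u else 0))"
    have "inner (e i) (w a u k) = 0" if "i < p" "a < p" "k < p" for i a u k
      using that by (simp add: w_def inner_add_right inner_e_N inner_e_P)
    then have "(\<Sum>a<p. \<Sum>u\<in>?B. \<Sum>i<p. \<Sum>j<p. inner (M i j (w a u i)) (w a u j))
      \<le> (\<Sum>a<p. \<Sum>u\<in>?B. l * (\<Sum>k<p. (norm (w a u k))\<^sup>2))"
      by (intro sum_mono second_variation) auto
    also have "\<dots> = l * (\<Sum>a<p. \<Sum>u\<in>?B. \<Sum>k<p. (norm (N a k u))\<^sup>2 + (if k = a then t\<^sup>2 * (norm (P u))\<^sup>2 else 0))"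
      unfolding sum_distrib_left
      by (intro sum.cong refl) (auto simp: w_def N_self power_mult_distrib)
    also have "\<dots> = l * ((\<Sum>a<p. \<Sum>u\<in>?B. \<Sum>k<p. (norm (N a k u))\<^sup>2) + t\<^sup>2 * (real p * d))"
      by (simp add: sum.distrib d_def sum_distrib_left mult.left_commute)
    also have "(\<Sum>a<p. \<Sum>u\<in>?B. \<Sum>k<p. (norm (N a k u))\<^sup>2) = K"
      unfolding K_def by (intro sum.cong refl) (rule sum.swap)
    finally have 1: "(\<Sum>a<p. \<Sum>u\<in>?B. \<Sum>i<p. \<Sum>j<p. inner (M i j (w a u i)) (w a u j))
      \<le> l * (K + t\<^sup>2 * (real p * d))" .
    \<comment> \<open>The term in \<open>t\<^sup>2\<close> could only arise for
      \<open>i = j = a\<close>, where \<open>N_self\<close> kills it.\<close>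
    have expand: "inner (M i j (w a u i)) (w a u j) =
        - inner (N a j (N i j (N a i u))) u
        + (if j = a then t * (norm (N a i u))\<^sup>2 else 0)
        + (if i = a then t * (norm (N a j u))\<^sup>2 else 0)"
      if ijau: "i < p" "j < p" "a < p" for a u i j
    proof -
      have "P (w a u i) = w a u i"
        using ijau linear_0[OF linear_P] linear_add[OF linear_P] linear_cmul[OF linear_P] P_N
        by (simp add: w_def P_eq_self[of "P u"] inner_e_P)
      then have "M i j (w a u i) = N i j (w a u i)"
        by (simp add: N_def)
      moreover have "N i j (P u) = N i j u"
        by (simp add: N_def P_eq_self inner_e_P)
      ultimately have Mw: "M i j (w a u i) = N i j (N a i u) + (if i = a then t *\<^sub>R N i j u else 0)"
        using ijau linear_0[OF linear_N[of i j]] linear_add[OF linear_N[of i j]]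
          linear_cmul[OF linear_N[of i j]]
        by (cases "i = a") (simp_all add: w_def)
      have c1: "inner (N i j (N a i u)) (N a j u) = - inner (N a j (N i j (N a i u))) u"
        using ijau by (simp add: N_skew[of a j "N i j (N a i u)"])
      have c2: "inner (N i a (N a i u)) (P u) = (norm (N a i u))\<^sup>2"
      proof -
        have "inner (N i a (N a i u)) (P u) = inner (N i a (N a i u)) u"
          using ijau by (simp add: inner_P[symmetric] P_N)
        also have "\<dots> = (norm (N a i u))\<^sup>2"
          using ijau by (simp add: N_skew[of i a "N a i u" u] N_swap[of a i u] power2_norm_eq_inner)
        finally show ?thesis .
      qed
      show ?thesis
        unfolding Mw using ijau c1 c2
        by (auto simp: w_def inner_add_left inner_add_right N_self power2_norm_eq_inner)
    qed
    have "(\<Sum>a<p. \<Sum>u\<in>?B. \<Sum>i<p. \<Sum>j<p. inner (M i j (w a u i)) (w a u j)) =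
      (\<Sum>a<p. \<Sum>u\<in>?B. \<Sum>i<p. \<Sum>j<p. - inner (N a j (N i j (N a i u))) u
        + (if j = a then t * (norm (N a i u))\<^sup>2 else 0)
        + (if i = a then t * (norm (N a j u))\<^sup>2 else 0))"
      by (intro sum.cong refl expand) auto
    also have "\<dots> = - (\<Sum>a<p. \<Sum>u\<in>?B. \<Sum>i<p. \<Sum>j<p. inner (N a j (N i j (N a i u))) u)
        + (\<Sum>a<p. \<Sum>u\<in>?B. \<Sum>i<p. t * (norm (N a i u))\<^sup>2)
        + (\<Sum>a<p. \<Sum>u\<in>?B. \<Sum>i<p. \<Sum>j<p. if i = a then t * (norm (N a j u))\<^sup>2 else 0)"
      by (simp add: sum.distrib sum_negf sum_subtractf)
    also have "(\<Sum>a<p. \<Sum>u\<in>?B. \<Sum>i<p. \<Sum>j<p. if i = a then t * (norm (N a j u))\<^sup>2 else 0)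
       = (\<Sum>a<p. \<Sum>u\<in>?B. \<Sum>j<p. t * (norm (N a j u))\<^sup>2)"
    proof (rule sum.cong[OF refl], rule sum.cong[OF refl])
      fix a u assume "a \<in> {..<p}"
      then show "(\<Sum>i<p. \<Sum>j<p. if i = a then t * (norm (N a j u))\<^sup>2 else 0) = (\<Sum>j<p. t * (norm (N a j u))\<^sup>2)"
        by (subst sum.swap) simp
    qed
    also have "(\<Sum>a<p. \<Sum>u\<in>?B. \<Sum>j<p. t * (norm (N a j u))\<^sup>2) = t * K"
      unfolding K_def sum_distrib_left by (intro sum.cong refl) (rule sum.swap)
    also have "(\<Sum>a<p. \<Sum>u\<in>?B. \<Sum>i<p. \<Sum>j<p. inner (N a j (N i j (N a i u))) u)
       = (\<Sum>a<p. \<Sum>i<p. \<Sum>j<p. trace_endo (\<lambda>u. N a j (N i j (N a i u))))"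
    proof (intro sum.cong refl)
      fix a
      have "(\<Sum>u\<in>?B. \<Sum>i<p. \<Sum>j<p. inner (N a j (N i j (N a i u))) u)
        = (\<Sum>i<p. \<Sum>u\<in>?B. \<Sum>j<p. inner (N a j (N i j (N a i u))) u)"
        by (rule sum.swap)
      also have "\<dots> = (\<Sum>i<p. \<Sum>j<p. trace_endo (\<lambda>u. N a j (N i j (N a i u))))"
        unfolding trace_endo_def by (intro sum.cong refl) (rule sum.swap)
      finally show "(\<Sum>u\<in>?B. \<Sum>i<p. \<Sum>j<p. inner (N a j (N i j (N a i u))) u)
        = (\<Sum>i<p. \<Sum>j<p. trace_endo (\<lambda>u. N a j (N i j (N a i u))))" .
    qed
    finally show ?thesis
      using 1 sum_trace_N_cube by (simp add: field_simps)
  qed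
  have "K \<ge> 0"
    unfolding K_def by (intro sum_nonneg) auto
  have bound: "K \<le> l * real p * d / 2 * t" if "t > 0" for t
  proof -
    \<comment> \<open>Here \<open>p \<ge> 4\<close> gives \<open>(real p - 2) / 2 \<ge> 1\<close>.
      At \<open>p = 4\<close> the terms \<open>l * K\<close> cancel exactly, and only the shift by
      \<open>t\<close> leaves a usable term \<open>2 * t * K\<close>.\<close>
    have "l * K \<le> l * (real p - 2) / 2 * K"
      using \<open>p \<ge> 4\<close> l_pos \<open>K \<ge> 0\<close> by (intro mult_right_mono) auto
    with ineq[of t] have "2 * t * K \<le> l * (K + t\<^sup>2 * (real p * d)) - l * K"
      by linarith
    then have "t * K \<le> t * (l * real p * d / 2 * t)"
      by (simp add: power2_eq_square algebra_simps)
    with that show ?thesis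
      by simp
  qed
  have "((\<lambda>t. l * real p * d / 2 * t) \<longlongrightarrow> l * real p * d / 2 * 0) (at_right 0)"
    by (intro tendsto_intros)
  moreover have "\<forall>\<^sub>F t in at_right 0. K \<le> l * real p * d / 2 * t"
    by (rule eventually_mono[OF eventually_at_right_less bound])
  ultimately have "K \<le> l * real p * d / 2 * 0"
    by (rule tendsto_lowerbound) simp
  with \<open>K \<ge> 0\<close> have "K = 0"
    by simp
  then have "\<forall>a<p. \<forall>j<p. \<forall>u\<in>?B. N a j u = 0"
    unfolding K_def by (simp add: sum_nonneg_eq_0_iff sum_nonneg)
  then have "\<forall>u\<in>?B. N i j u = 0"
    using assms by blast
  then show ?thesis
    using linear_eq_stdbasis[OF linear_N[OF assms(2,3)] linear_zero] by (simp add: fun_eq_iff)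
qed

section \<open>Splitting of the form along the span of the frame\<close>

text \<open>Multilinearity reduces to arguments that are frame vectors or lie in the complement.
  Then some \<open>e m\<close> is missing, and invariance under an operator carrying
  \<open>e m\<close> to a multiple of the frame vector in slot \<open>k0\<close> isolates
  \<open>F Y\<close>.\<close>

lemma form_mixed_eq_0:
  assumes M0: "\<And>i j v. i < p \<Longrightarrow> j < p \<Longrightarrow> M i j (P v) = 0"
    and k: "k0 < p" "k1 < p" "k0 \<noteq> k1"
    and Y: "P (Y k0) = 0" "P (Y k1) = Y k1"
  shows "F Y = 0"
proof -
  have basis: "F Z = 0"
    if Z: "\<And>k. k < p \<Longrightarrow> Z k \<in> e ` {..<p} \<or> P (Z k) = Z k"
      and i0: "i0 < p" "Z k0 = e i0" and Zk1: "P (Z k1) = Z k1" for Z i0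
  proof -
    have notin: "P (e i) \<noteq> e i" if "i < p" for i
      using that norm_e[OF that] by (auto simp: P_e)
    \<comment> \<open>Pigeonhole: slot \<open>k1\<close> lies in the complement, so at most
      \<open>p - 1\<close> slots hold frame vectors.\<close>
    have "\<exists>m<p. \<forall>k<p. Z k \<noteq> e m"
    proof (rule ccontr)
      assume "\<not> ?thesis"
      then have "\<exists>k<p. Z k = e m" if "m < p" for m
        using that by blast
      then have "e ` {..<p} \<subseteq> Z ` ({..<p} - {k1})"
        using Zk1 notin by (force simp: image_iff Bex_def)
      then have "card (e ` {..<p}) \<le> card (Z ` ({..<p} - {k1}))"
        by (intro card_mono) auto
      also have "\<dots> \<le> card ({..<p} - {k1})"
        by (rule card_image_le) simp
      also have "\<dots> < p"
        using k by simp
      also have "card (e ` {..<p}) = p"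
        by (simp add: card_image inj_on_e)
      finally show False by simp
    qed
    then obtain m where m: "m < p" "\<And>k. k < p \<Longrightarrow> Z k \<noteq> e m"
      by blast
    have mi: "m \<noteq> i0"
      using m i0 k by auto
    show ?thesis
    proof (cases "\<exists>k<p. k \<noteq> k0 \<and> Z k = e i0")
      case True
      then show ?thesis
        using i0 k by (auto intro: form_zero[of k0])
    next
      case False
      \<comment> \<open>\<open>M m i0\<close> sends \<open>e m\<close> back to
        \<open>l *\<^sub>R e i0\<close> and annihilates every other argument, so the invariance sum
        reduces to \<open>l * F Z\<close>.\<close>
      let ?Z = "Z(k0 := e m)"
      have "F (?Z(k := M m i0 (?Z k))) = 0" if "k < p" "k \<noteq> k0" for k
      proof -
        have "M m i0 (Z k) = 0"
          using Z[OF \<open>k < p\<close>]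
        proof
          assume "Z k \<in> e ` {..<p}"
          then obtain q where "q < p" "Z k = e q" by auto
          then show ?thesis
            using m i0 mi that False by (metis M_e)
        next
          assume "P (Z k) = Z k"
          then show ?thesis
            using M0[OF m(1) i0(1), of "Z k"] by simp
        qed
        then show ?thesis
          using that by (simp add: form_0)
      qed
      then have "(\<Sum>k\<in>{..<p} - {k0}. F (?Z(k := M m i0 (?Z k)))) = 0"
        by (intro sum.neutral) auto
      then have "F (?Z(k0 := M m i0 (?Z k0))) = 0"
        using M_invariant[OF m(1) i0(1), of ?Z] k by (simp add: sum.remove[of _ k0])
      then have "l * F (Z(k0 := e i0)) = 0"
        using m i0 mi k by (simp add: M_e form_scale)
      moreover have "Z(k0 := e i0) = Z"
        using i0 by auto
      ultimately show ?thesis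
        using l_pos by simp
    qed
  qed
  have decompose: "F Z = (\<Sum>i<p. inner (e i) (Z a) * F (Z(a := e i))) + F (Z(a := P (Z a)))"
    if "a < p" for Z a
  proof -
    have "F Z = F (Z(a := (\<Sum>i<p. inner (e i) (Z a) *\<^sub>R e i) + P (Z a)))"
      by (simp add: P_def)
    then show ?thesis
      using that by (simp add: form_add form_sum form_scale)
  qed
  \<comment> \<open>\<open>A\<close> is the set of slots whose entries are still arbitrary; each
    induction step splits one of them with \<open>decompose\<close>.\<close>
  have general: "F Z = 0"
    if "finite A" "k0 \<notin> A" "k1 \<notin> A" "A \<subseteq> {..<p}"
      "\<And>k. k < p \<Longrightarrow> k \<notin> A \<Longrightarrow> Z k \<in> e ` {..<p} \<or> P (Z k) = Z k"
      "i0 < p" "Z k0 = e i0" "P (Z k1) = Z k1" for A Z i0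
    using that
  proof (induction A arbitrary: Z rule: finite_induct)
    case empty
    then show ?case
      by (intro basis) auto
  next
    case (insert a A)
    have a: "a < p" "a \<noteq> k0" "a \<noteq> k1"
      using insert.prems by auto
    have "F (Z(a := e i)) = 0" if "i < p" for i
      using a that insert.prems by (intro insert.IH) auto
    moreover have "F (Z(a := P (Z a))) = 0"
      using a insert.prems by (intro insert.IH) (auto simp: P_P)
    ultimately show ?case
      by (simp add: decompose[OF a(1), of Z])
  qed
  have "F (Y(k0 := e i)) = 0" if "i < p" for i
    using that k Y by (intro general[of "{..<p} - {k0, k1}" _ i]) auto
  then show ?thesis
    using decompose[OF k(1), of Y] Y k by (simp add: form_0)
qed

lemma DIM_eq:
  assumes "\<And>v. P v = 0"
  shows "DIM('a) = p"
proof -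
  have "v \<in> span (e ` {..<p})" for v
  proof -
    have "v = (\<Sum>k<p. inner (e k) v *\<^sub>R e k)"
      using assms[of v] by (simp add: P_def)
    also have "\<dots> \<in> span (e ` {..<p})"
      by (intro span_sum span_scale span_base) auto
    finally show ?thesis .
  qed
  then have "dim (e ` {..<p}) = DIM('a)"
    by (metis UNIV_eq_I dim_UNIV dim_span)
  moreover have "independent (e ` {..<p})"
  proof (rule pairwise_orthogonal_independent)
    show "pairwise orthogonal (e ` {..<p})"
      by (auto simp: pairwise_def orthogonal_def inner_e)
    show "0 \<notin> e ` {..<p}"
      using norm_e by force
  qed
  ultimately show ?thesis
    by (simp add: dim_eq_card_independent card_image inj_on_e)
qed

end

section \<open>Euclidean n-Lie algebras\<close>

lemma multilinear_bracket_form: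
  assumes "multilinear n br"
  shows "multilinear (n + 1) (bracket_form n br)"
  unfolding multilinear_def
proof (intro allI impI)
  fix xs :: "'a list" and i assume xs: "length xs = n + 1" and i: "i < n + 1"
  show "linear (\<lambda>y. bracket_form n br (xs[i := y]))"
  proof (cases "i = n")
    case True
    then show ?thesis
      using xs unfolding bracket_form_def
      by (intro linearI) (simp_all add: inner_add_right)
  next
    case False
    have lin: "linear (\<lambda>y. br ((take n xs)[i := y]))"
      using assms xs i False by (simp add: multilinear_def)
    show ?thesis
      using xs i False linear_add[OF lin] linear_cmul[OF lin] unfolding bracket_form_def
      by (intro linearI) (simp_all add: take_update_swap inner_add_left)
  qed
qed

text \<open>The metric condition handles a repetition in slots \<open>n - 1\<close> and
  \<open>n\<close>. A repetition in slot \<open>n\<close> and an earlier slot is brought there by a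
  swap inside the bracket.\<close>

lemma alternating_bracket_form:
  assumes "multilinear n br" "alternating n br" "metric_bracket n br"
  shows "alternating (n + 1) (bracket_form n br)"
  unfolding alternating_def
proof (intro allI impI)
  fix xs :: "'a list" assume xs: "length xs = n + 1"
    and "\<exists>i j. i < j \<and> j < n + 1 \<and> xs ! i = xs ! j"
  then obtain i j where ij: "i < j" "j < n + 1" "xs ! i = xs ! j" by blast
  define G where "G x = br (map x [0..<n])" for x
  have G: "alt_multilinear n G"
    unfolding G_def using assms by (intro alt_multilinear_of_lists)
  have T: "bracket_form n br xs = inner (G (\<lambda>k. xs ! k)) (xs ! n)"
  proof -
    have "take n xs = map (\<lambda>k. xs ! k) [0..<n]"
      using xs by (intro nth_equalityI) auto
    then show ?thesis
      by (simp add: bracket_form_def G_def)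
  qed
  have self: "inner (G x) (x (n - 1)) = 0" if "n > 0" for x
  proof -
    have "[0..<n] = [0..<n - 1] @ [n - 1]"
      using upt_Suc_append[of 0 "n - 1"] that by simp
    then have "G x = br (map x [0..<n - 1] @ [x (n - 1)])"
      by (simp add: G_def)
    then have "inner (G x) (x (n - 1)) = - inner (G x) (x (n - 1))"
      using assms(3)[unfolded metric_bracket_def, rule_format, of "map x [0..<n - 1]" "x (n - 1)" "x (n - 1)"]
      by simp
    then show ?thesis
      by linarith
  qed
  consider "j < n" | "j = n" "i = n - 1" | "j = n" "i < n - 1"
    using ij by linarith
  then show "bracket_form n br xs = 0"
  proof cases
    case 1
    then have "G (\<lambda>k. xs ! k) = 0"
      using ij by (intro alt_multilinear_zero[OF G, of i j]) auto
    then show ?thesis by (simp add: T)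
  next
    case 2
    then show ?thesis
      using self[of "\<lambda>k. xs ! k"] ij by (simp add: T)
  next
    case 3
    let ?x = "\<lambda>k. xs ! k"
    have "G (?x(i := ?x (n - 1), n - 1 := ?x i)) = - G (?x(i := ?x i, n - 1 := ?x (n - 1)))"
      using 3 by (intro alt_multilinear_swap[OF G]) auto
    then have "inner (G ?x) (xs ! n) = - inner (G (?x(i := ?x (n - 1), n - 1 := ?x i))) (xs ! n)"
      by simp
    also have "\<dots> = 0"
      using self[of "?x(i := ?x (n - 1), n - 1 := ?x i)"] ij 3 by simp
    finally show ?thesis by (simp add: T)
  qed
qed

text \<open>The fundamental identity makes the inner derivation act on the first \<open>n\<close>
  slots, and the metric condition moves it to the last one with a sign. This treats free slots
  \<open>n - 1\<close> and \<open>n\<close>; \<open>contraction_endo_derivation\<close> gives the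
  others.\<close>

lemma bracket_form_invariant:
  fixes br :: "'a::euclidean_space list \<Rightarrow> 'a"
  assumes n: "n \<ge> 2" and lie: "n_Lie n br" and metric: "metric_bracket n br"
  shows "invariant_form (n + 1) (\<lambda>x. bracket_form n br (map x [0..<n + 1]))"
proof -
  define F where "F = (\<lambda>x. bracket_form n br (map x [0..<n + 1]))"
  have F_eq: "F x = inner (br (map x [0..<n])) (x n)" for x
    by (simp add: F_def bracket_form_def nth_append)
  have multi: "multilinear n br" and "alternating n br"
    using lie by (auto simp: n_Lie_def)
  then have alt: "alt_multilinear (n + 1) F"
    unfolding F_def
    using metric by (intro alt_multilinear_of_lists multilinear_bracket_form alternating_bracket_form)
  have upt: "[0..<n] = [0..<n - 1] @ [n - 1]"
    using upt_Suc_append[of 0 "n - 1"] n by simp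
  have base: "(\<Sum>k<n + 1. F (Y(k := contraction_endo F (n - 1) n x (Y k)))) = 0" for x Y
  proof -
    define C where "C = contraction_endo F (n - 1) n x"
    define Xs where "Xs = map x [0..<n - 1]"
    have C: "C v = br (Xs @ [v])" for v
    proof (rule vector_eq_rdot[THEN iffD1], rule allI)
      fix w
      have "inner (C v) w = F (x(n - 1 := v, n := w))"
        unfolding C_def using alt by (rule inner_contraction_endo) simp
      also have "map (x(n - 1 := v, n := w)) [0..<n] = Xs @ [v]"
        unfolding upt using n by (auto simp: Xs_def)
      then have "F (x(n - 1 := v, n := w)) = inner (br (Xs @ [v])) w"
        by (simp add: F_eq)
      finally show "inner (C v) w = inner (br (Xs @ [v])) w" .
    qed
    let ?Ys = "map Y [0..<n]"
    have lenXs: "length Xs = n - 1"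
      by (simp add: Xs_def)
    have "C (br ?Ys) = (\<Sum>i<n. br (?Ys[i := C (?Ys ! i)]))"
      unfolding C by (rule lie[unfolded n_Lie_def, THEN conjunct2, THEN conjunct2, rule_format])
        (simp_all add: lenXs)
    also have "\<dots> = (\<Sum>i<n. br (map (Y(i := C (Y i))) [0..<n]))"
      by (intro sum.cong refl) (simp add: map_upt_fun_upd)
    finally have "(\<Sum>i<n. F (Y(i := C (Y i)))) = inner (C (br ?Ys)) (Y n)"
      by (simp add: F_eq inner_sum_left)
    also have "\<dots> = - inner (br ?Ys) (C (Y n))"
      using metric[unfolded metric_bracket_def, rule_format, of Xs "br ?Ys" "Y n"] lenXs
      by (simp add: C inner_commute)
    also have "\<dots> = - F (Y(n := C (Y n)))"
    proof -
      have "map (Y(n := C (Y n))) [0..<n] = ?Ys" by simp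
      then show ?thesis by (simp only: F_eq fun_upd_same)
    qed
    finally show ?thesis
      by (simp add: C_def)
  qed
  have "invariant_form (n + 1) F"
  proof
    show "alt_multilinear (n + 1) F" by (rule alt)
    show "(\<Sum>k<n + 1. F (Y(k := contraction_endo F i j x (Y k)))) = 0"
      if "i < n + 1" "j < n + 1" "i \<noteq> j" for i j x Y
      using n that by (intro contraction_endo_derivation[OF alt base]) auto
  qed
  then show ?thesis
    by (simp only: F_def)
qed

section \<open>Irreducibility and the volume form\<close>

lemma lie_gen_preserves:
  assumes "A \<in> lie_gen S" "subspace W" "\<And>A w. A \<in> S \<Longrightarrow> w \<in> W \<Longrightarrow> A w \<in> W" "w \<in> W"
  shows "A w \<in> W"
  using assms(1,4)
  by (induction arbitrary: w rule: lie_gen.induct)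
    (auto simp: assms(3) subspace_0[OF assms(2)] intro: subspace_add[OF assms(2)]
      subspace_scale[OF assms(2)] subspace_diff[OF assms(2)])

text \<open>The outermost contraction prepends its vector first, hence the reversal.\<close>

lemma contract_list_apply: "contract_list Xs \<omega> ys = \<omega> (rev Xs @ ys)"
  by (induction Xs arbitrary: ys) (simp_all add: contract_list_def contract_def)

theorem theorem6p1:
  fixes n :: nat and br :: "'a::euclidean_space list \<Rightarrow> 'a"
  assumes "n \<ge> 2"
    and "n_Lie n br"
    and "metric_bracket n br"
    and "\<exists>xs. length xs = n + 1 \<and> bracket_form n br xs \<noteq> 0"
    and "irreducible_form (n + 1) (bracket_form n br)"
  shows "n = 2 \<or>
         (n = DIM('a) - 1 \<and>
          (\<exists>c vol. volume_form vol \<and>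
             (\<forall>xs. length xs = n + 1 \<longrightarrow> bracket_form n br xs = c * vol xs)))"
proof (cases "n = 2")
  case False
  let ?T = "bracket_form n br"
  define F where "F = (\<lambda>x. ?T (map x [0..<n + 1]))"
  have T_map: "?T (map x [0..<n + 1]) = F x" for x
    by (simp add: F_def)
  have T_eq: "?T xs = F (\<lambda>k. xs ! k)" if "length xs = n + 1" for xs
    using map_nth[of xs] that by (simp add: F_def del: upt_Suc)
  have multi: "multilinear (n + 1) ?T" and altT: "alternating (n + 1) ?T"
    using assms(2,3) multilinear_bracket_form alternating_bracket_form unfolding n_Lie_def by blast+
  interpret invariant_form "n + 1" F
    unfolding F_def by (rule bracket_form_invariant) (use assms(1-3) in auto)
  obtain e :: "nat \<Rightarrow> 'a" where e: "\<And>i. norm (e i) = 1"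
    and max: "\<And>x. F x \<le> F e * (\<Prod>i<n + 1. norm (x i))"
    using multilinear_attains_max[OF multi] unfolding F_def by blast
  have "F e > 0"
  proof -
    obtain xs where xs: "length xs = n + 1" "?T xs \<noteq> 0"
      using assms(4) by blast
    define x where "x = (\<lambda>k. xs ! k)"
    have "F x \<noteq> 0"
      using xs by (simp add: T_eq x_def)
    \<comment> \<open>Changing the sign of one argument turns a nonzero value into a positive
      one.\<close>
    moreover have "F (x(0 := - x 0)) = - F x"
      using form_minus[of 0 x "x 0"] by simp
    ultimately obtain y where "F y > 0"
      by (metis linorder_neqE_linordered_idom neg_0_less_iff_less)
    then have "F e * (\<Prod>i<n + 1. norm (y i)) > 0"
      using max[of y] by linarith
    then show ?thesis
      by (simp add: zero_less_mult_iff prod_nonneg not_less[symmetric] del: prod.lessThan_Suc)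
        (meson norm_ge_zero not_less prod_nonneg)
  qed
  interpret maximal_invariant_form "n + 1" F e "F e"
    by unfold_locales (use e max \<open>F e > 0\<close> in auto)
  \<comment> \<open>Excluding \<open>n = 2\<close> is what makes \<open>p = n + 1\<close> at least
    4.\<close>
  have M0: "M i j (P v) = 0" if "i < n + 1" "j < n + 1" for i j v
  proof -
    have "n + 1 \<ge> 4"
      using assms(1) False by simp
    from N_eq_0[OF this that, of v] show ?thesis
      unfolding N_def .
  qed
  define W where "W = {w. P w = 0}"
  have W: "subspace W"
    unfolding W_def by (rule linear_subspace_kernel[OF linear_P])
  \<comment> \<open>The component of \<open>A w\<close> orthogonal to \<open>W\<close> is tested
    against \<open>P v\<close>; the result is a value of the form with one argument in
    \<open>W\<close> and one in its complement.\<close>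
  have gen: "A w \<in> W"
    if A_gen: "A \<in> {form_to_endo (contract_list Xs ?T) | Xs. length Xs = n + 1 - 2}" and w: "w \<in> W" for A w
  proof -
    obtain Xs where Xs: "length Xs = n - 1" and A: "A = form_to_endo (contract_list Xs ?T)"
      using A_gen by auto
    have lin: "linear (\<lambda>b. ?T (rev Xs @ [w, b]))"
    proof -
      have "linear (\<lambda>b. ?T ((rev Xs @ [w, 0])[n := b]))"
        using multi Xs assms(1) unfolding multilinear_def by simp
      moreover have "n = Suc (length Xs)"
        using Xs assms(1) by simp
      then have "(rev Xs @ [w, 0])[n := b] = rev Xs @ [w, b]" for b
        by (simp add: list_update_append)
      ultimately show ?thesis
        by simp
    qed
    have "inner (A w) (P v) = 0" for v
    proof -
      let ?xs = "rev Xs @ [w, P v]"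
      have "inner (A w) (P v) = ?T ?xs"
        unfolding A form_to_endo_def contract_list_apply by (rule inner_sum_Basis_linear[OF lin])
      also have "\<dots> = F (\<lambda>k. ?xs ! k)"
        using Xs assms(1) by (intro T_eq) simp
      also have "\<dots> = 0"
      proof (rule form_mixed_eq_0[OF M0, of "n - 1" n])
        have "?xs ! (n - 1) = w"
          using Xs by (simp add: nth_append)
        then show "P (?xs ! (n - 1)) = 0"
          using w by (simp only: W_def mem_Collect_eq)
        have "?xs ! n = P v"
          using Xs assms(1) by (auto simp: nth_append)
        then show "P (?xs ! n) = ?xs ! n"
          by (simp only: P_P)
      qed (use assms(1) in auto)
      finally show ?thesis .
    qed
    then have "inner (P (A w)) (P (A w)) = 0"
      by (simp only: inner_P P_P)
    then show ?thesis
      by (simp only: W_def mem_Collect_eq inner_eq_zero_iff)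
  qed
  have "A w \<in> W"
    if "A \<in> lie_gen {form_to_endo (contract_list Xs ?T) | Xs. length Xs = n + 1 - 2}" "w \<in> W" for A w
    using gen by (intro lie_gen_preserves[OF that(1) W _ that(2)])
  then have "W = {0} \<or> W = UNIV"
    by (intro assms(5)[unfolded irreducible_form_def acts_irreducibly_def, rule_format, OF W])
  moreover have "e 0 \<in> W" "e 0 \<noteq> 0"
  proof -
    show "e 0 \<in> W"
      unfolding W_def by (intro CollectI P_e) simp
    show "e 0 \<noteq> 0"
      using e[of 0] by auto
  qed
  ultimately have "W = UNIV"
    by blast
  then have "P v = 0" for v
    unfolding W_def by blast
  then have DIM: "DIM('a) = n + 1"
    by (rule DIM_eq)
  \<comment> \<open>The frame \<open>e\<close> is now an orthonormal basis, and dividing by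
    \<open>F e\<close> normalises the value on it to 1.\<close>
  have "volume_form (\<lambda>xs. ?T xs / F e)"
    unfolding volume_form_def DIM
  proof (intro conjI exI[of _ "map e [0..<n + 1]"] allI impI)
    show "multilinear (n + 1) (\<lambda>xs. ?T xs / F e)"
      unfolding multilinear_def
    proof (intro allI impI)
      fix xs :: "'a list" and i assume "length xs = n + 1" "i < n + 1"
      then have "linear (\<lambda>y. ?T (xs[i := y]))"
        using multi by (simp add: multilinear_def)
      from linear_compose_scale_right[OF this, of "inverse (F e)"]
      show "linear (\<lambda>y. ?T (xs[i := y]) / F e)"
        by (simp add: field_simps)
    qed
    show "alternating (n + 1) (\<lambda>xs. ?T xs / F e)"
      using altT by (simp add: alternating_def)
    show "inner (map e [0..<n + 1] ! i) (map e [0..<n + 1] ! j) = (if i = j then 1 else 0)"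
      if "i < n + 1" "j < n + 1" for i j
      using that by (simp add: inner_e del: upt_Suc)
    show "?T (map e [0..<n + 1]) / F e = 1"
      using \<open>F e > 0\<close> by (simp only: T_map) simp
  qed simp
  moreover have "\<forall>xs. length xs = n + 1 \<longrightarrow> ?T xs = F e * (?T xs / F e)"
    using \<open>F e > 0\<close> by simp
  ultimately have "\<exists>c vol. volume_form vol \<and> (\<forall>xs. length xs = n + 1 \<longrightarrow> ?T xs = c * vol xs)"
    by blast
  then show ?thesis
    using DIM by simp
qed simp

end
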